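(* Let $k,d\ge 1$ be integers. There exists a generally $k$-neighborly embedding of $\mathbb{R}^d$ into $\mathbb{R}^{2k+d-1}$, and so $p_g(k,d)\le 2k+d-1$.
   Context: An embedding is a map which is a homeomorphism onto its image. A polytope is $k$-neighborly if any set of $k$ or fewer of its vertices forms a face (is the vertex set of a face, the polytope itself being counted as a face); a finite point set is $k$-neighborly if it is the vertex set of a $k$-neighborly polytope. Let $\varphi:\mathbb{R}^d\to\mathbb{R}^p$ be an embedding, and for each $n\in\mathbb{N}$ let $G_n\subset\mathbb{R}^{dn}$ consist of all configurations of $n$ points in $\mathbb{R}^d$ which are mapped to $k$-neighborly sets by $\varphi$. Then $\varphi$ is generally $k$-neighborly if $G_n$ contains a set that is open and dense in $\mathbb{R}^{dn}$ for all $n$. $p_g(k,d)$ denotes the smallest dimension $p$ for which a generally $k$-neighborly embedding $\varphi:\mathbb{R}^d\to\mathbb{R}^p$ exists. *)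

theory Defs
  imports "HOL-Analysis.Analysis" "HOL-Library.Function_Algebras"
begin

text \<open>
  The dimension of the target space is quantified over in the definition of \<open>p_g\<close>, so the
  Euclidean spaces are those given by \<^const>\<open>Euclidean_space\<close>: \<open>\<real>\<^sup>p\<close> is the set of
  sequences \<open>x :: nat \<Rightarrow> real\<close> with \<open>x i = 0\<close> for \<open>i \<ge> p\<close>.  The pointwise vector space
  structure on functions makes the library's notions of polytope, face and extreme point
  available there.
\<close>

instantiation "fun" :: (type, real_vector) real_vector
begin

definition scaleR_fun :: "real \<Rightarrow> ('a \<Rightarrow> 'b) \<Rightarrow> 'a \<Rightarrow> 'b"
  where "scaleR_fun c f = (\<lambda>i. c *\<^sub>R f i)"

instance
  by standard (simp_all add: scaleR_fun_def fun_eq_iff scaleR_add_left scaleR_add_right)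

end

definition vertices :: "'a::real_vector set \<Rightarrow> 'a set"
  where "vertices P = {v. v extreme_point_of P}"

text \<open>
  The improper faces count: \<open>P face_of P\<close> and \<open>{} face_of P\<close> hold for every polytope \<open>P\<close>.
\<close>

definition neighborly_polytope :: "nat \<Rightarrow> 'a::real_vector set \<Rightarrow> bool"
  where "neighborly_polytope k P \<longleftrightarrow>
    polytope P \<and>
    (\<forall>S. S \<subseteq> vertices P \<and> finite S \<and> card S \<le> k \<longrightarrow> (\<exists>F. F face_of P \<and> vertices F = S))"

text \<open>
  No ambient dimension appears here: a polytope is the convex hull of its vertices, so it lies
  in \<open>\<real>\<^sup>p\<close> as soon as they do.
\<close>

definition neighborly_set :: "nat \<Rightarrow> 'a::real_vector set \<Rightarrow> bool"
  where "neighborly_set k V \<longleftrightarrow> finite V \<and> (\<exists>P. neighborly_polytope k P \<and> vertices P = V)"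

text \<open>\<open>\<real>\<^sup>d\<^sup>n\<close> as the space of \<open>n\<close>-tuples of points of \<open>\<real>\<^sup>d\<close>.\<close>

definition configuration_space :: "nat \<Rightarrow> nat \<Rightarrow> (nat \<Rightarrow> nat \<Rightarrow> real) topology"
  where "configuration_space d n = product_topology (\<lambda>_. Euclidean_space d) {..<n}"

definition neighborly_configurations ::
    "nat \<Rightarrow> nat \<Rightarrow> ((nat \<Rightarrow> real) \<Rightarrow> (nat \<Rightarrow> real)) \<Rightarrow> nat \<Rightarrow> (nat \<Rightarrow> nat \<Rightarrow> real) set"
  where "neighborly_configurations k d \<phi> n =
    {x \<in> topspace (configuration_space d n). neighborly_set k ((\<lambda>i. \<phi> (x i)) ` {..<n})}"

definition generally_neighborly_embedding ::
    "nat \<Rightarrow> nat \<Rightarrow> nat \<Rightarrow> ((nat \<Rightarrow> real) \<Rightarrow> (nat \<Rightarrow> real)) \<Rightarrow> bool"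
  where "generally_neighborly_embedding k d p \<phi> \<longleftrightarrow>
    embedding_map (Euclidean_space d) (Euclidean_space p) \<phi> \<and>
    (\<forall>n. \<exists>U. U \<subseteq> neighborly_configurations k d \<phi> n \<and>
      openin (configuration_space d n) U \<and>
      configuration_space d n closure_of U = topspace (configuration_space d n))"

definition p_g :: "nat \<Rightarrow> nat \<Rightarrow> nat"
  where "p_g k d = (LEAST p. \<exists>\<phi>. generally_neighborly_embedding k d p \<phi>)"

end

theory Submission
  imports Defs "HOL-Computational_Algebra.Polynomial"
begin

text \<open>
  The embedding extends \<open>(x\<^sub>0, \<dots>, x\<^bsub>d-1\<^esub>)\<close> by the powers
  \<open>x\<^sub>0\<^sup>2, \<dots>, x\<^sub>0\<^bsup>2k\<^esup>\<close>, so that every polynomial of degree at most \<open>2k\<close> in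
  \<open>x\<^sub>0\<close> is the restriction of an affine function.  If the points of a configuration have
  distinct coordinates \<open>x\<^sub>0\<close>, then for any set \<open>S\<close> of at most \<open>k\<close> of them the
  polynomial \<open>\<Prod>\<^bsub>s\<in>S\<^esub> (x\<^sub>0 - s\<^sub>0)\<^sup>2\<close> yields a supporting hyperplane that meets
  the image of the configuration exactly in \<open>S\<close>, as for the cyclic polytopes.  Having distinct
  first coordinates is an open and dense condition.
\<close>

section \<open>Supporting hyperplanes and neighborliness\<close>

lemma face_of_Int_supporting_hyperplane_linear:
  fixes P :: "'a::real_vector set" and L :: "'a \<Rightarrow> real"
  assumes "convex P" "linear L" and ge: "\<And>x. x \<in> P \<Longrightarrow> c \<le> L x"
  shows "{x \<in> P. L x = c} face_of P"
  unfolding face_of_def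
proof (intro conjI ballI impI)
  interpret linear L by fact
  show "{x \<in> P. L x = c} \<subseteq> P" by blast
  show "convex {x \<in> P. L x = c}"
    using convexD[OF \<open>convex P\<close>] by (auto intro!: convexI simp: add scale simp flip: distrib_right)
  fix a b x assume ab: "a \<in> P" "b \<in> P" and "x \<in> {x \<in> P. L x = c}" and "x \<in> open_segment a b"
  then obtain u where u: "0 < u" "u < 1" "L ((1 - u) *\<^sub>R a + u *\<^sub>R b) = c"
    by (auto simp: in_segment)
  \<comment> \<open>Both summands are nonnegative, so each vanishes, and \<open>0 < u < 1\<close>
    forces \<open>L a = L b = c\<close>.\<close>
  then have *: "(1 - u) * (L a - c) + u * (L b - c) = 0"
    by (simp add: add diff scale algebra_simps)
  have "(1 - u) * (L a - c) = 0 \<and> u * (L b - c) = 0"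
    using * ge[OF ab(1)] ge[OF ab(2)] u by (subst (asm) add_nonneg_eq_0_iff) auto
  with u ab show "a \<in> {x \<in> P. L x = c}" "b \<in> {x \<in> P. L x = c}"
    by auto
qed

text \<open>Singletons \<open>S\<close>, allowed because \<open>k \<ge> 1\<close>, show that every
  point of \<open>V\<close> is a vertex of the hull. For general \<open>S\<close> the hyperplane
  cuts out a face, whose vertices are those of the hull lying on it.\<close>

lemma neighborly_set_if_supporting_hyperplanes:
  fixes V :: "'a::real_vector set"
  assumes "finite V" "k \<ge> 1"
    and hyp: "\<And>S. S \<subseteq> V \<Longrightarrow> card S \<le> k \<Longrightarrow>
      \<exists>(L :: 'a \<Rightarrow> real) c. linear L \<and> (\<forall>v\<in>V. c \<le> L v) \<and> {v \<in> V. L v = c} = S"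
  shows "neighborly_set k V"
proof -
  let ?P = "convex hull V"
  have ge: "c \<le> L x" if "linear L" "\<forall>v\<in>V. c \<le> L v" "x \<in> ?P" for L :: "'a \<Rightarrow> real" and c x
  proof -
    have "convex (L -` {c..})"
      using that(1) by (intro convex_linear_vimage) auto
    then have "?P \<subseteq> L -` {c..}"
      using that(2) by (intro hull_minimal) auto
    with that(3) show ?thesis by auto
  qed
  have extreme: "v extreme_point_of ?P" if "v \<in> V" for v
  proof -
    obtain L :: "'a \<Rightarrow> real" and c
      where L: "linear L" "\<forall>w\<in>V. c \<le> L w" "{w \<in> V. L w = c} = {v}"
      using hyp[of "{v}"] \<open>v \<in> V\<close> \<open>k \<ge> 1\<close> by auto
    \<comment> \<open>The open half-space contains all points of \<open>V\<close> except
      \<open>v\<close>, hence also their hull, while \<open>L v = c\<close>.\<close>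
    have "convex (L -` {c<..})"
      using L(1) by (intro convex_linear_vimage) auto
    moreover have "V - {v} \<subseteq> L -` {c<..}"
      using L(2,3) by (force simp: less_le)
    ultimately have "convex hull (V - {v}) \<subseteq> L -` {c<..}"
      by (rule hull_minimal[rotated])
    then have "v \<notin> convex hull (V - {v})"
      using L(3) by auto
    then have "v extreme_point_of convex hull (insert v (V - {v}))"
      using \<open>finite V\<close> by (intro extreme_point_of_convex_hull_insert) auto
    with \<open>v \<in> V\<close> show ?thesis by (simp add: insert_absorb)
  qed
  have vert: "vertices ?P = V"
    unfolding vertices_def using extreme extreme_point_of_convex_hull by blast
  have "\<exists>F. F face_of ?P \<and> vertices F = S" if S: "S \<subseteq> V" "card S \<le> k" for S
  proof -
    obtain L :: "'a \<Rightarrow> real" and c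
      where L: "linear L" "\<forall>w\<in>V. c \<le> L w" "{w \<in> V. L w = c} = S"
      using hyp[OF S] by blast
    let ?F = "{x \<in> ?P. L x = c}"
    have F: "?F face_of ?P"
      by (intro face_of_Int_supporting_hyperplane_linear L ge) (use L in auto)
    have "vertices ?F = vertices ?P \<inter> ?F"
      unfolding vertices_def using extreme_point_of_face[OF F] by blast
    also have "\<dots> = S"
      unfolding vert using L(3) hull_subset[of V convex] by blast
    finally show ?thesis using F by blast
  qed
  then have "neighborly_polytope k ?P"
    unfolding neighborly_polytope_def vert using \<open>finite V\<close> by (auto simp: polytope_def)
  with vert \<open>finite V\<close> show ?thesis
    unfolding neighborly_set_def by blast
qed

section \<open>The moment map and its polynomials\<close>

text \<open>The indices \<open>d, ..., 2 * k + d - 2\<close> carry the exponents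
  \<open>2, ..., 2 * k\<close>; the first power is already coordinate 0 when
  \<open>d \<ge> 1\<close>.\<close>

definition moment_map :: "nat \<Rightarrow> nat \<Rightarrow> (nat \<Rightarrow> real) \<Rightarrow> nat \<Rightarrow> real"
  where "moment_map k d x i =
    (if i < 2 * k + d - 1 then if i < d then x i else x 0 ^ (i + 2 - d) else 0)"

lemma continuous_map_Euclidean_space_coord:
  "continuous_map (Euclidean_space d) euclideanreal (\<lambda>x. x i)"
  unfolding Euclidean_space_def
  by (intro continuous_map_from_subtopology continuous_map_product_projection) simp

text \<open>Truncation to the first \<open>d\<close> coordinates is a continuous left inverse;
  \<open>k \<ge> 1\<close> gives \<open>d \<le> 2 * k + d - 1\<close>, so none of these coordinates
  is lost.\<close>

lemma embedding_map_moment_map: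
  assumes "k \<ge> 1"
  shows "embedding_map (Euclidean_space d) (Euclidean_space (2 * k + d - 1)) (moment_map k d)"
proof -
  let ?g = "\<lambda>(y :: nat \<Rightarrow> real) i. if i < d then y i else 0"
  have coord: "continuous_map (Euclidean_space d) euclideanreal
      (\<lambda>x. if i < d then x i else x 0 ^ (i + 2 - d))" for i
    by (cases "i < d") (auto intro!: continuous_map_Euclidean_space_coord continuous_map_real_pow)
  have "continuous_map (Euclidean_space d) (Euclidean_space (2 * k + d - 1)) (moment_map k d)"
    unfolding moment_map_def[abs_def]
    using coord by (subst continuous_map_componentwise_Euclidean_space) blast
  moreover have "continuous_map (Euclidean_space (2 * k + d - 1)) (Euclidean_space d) ?g"
    by (subst continuous_map_componentwise_Euclidean_space)
      (auto intro: continuous_map_Euclidean_space_coord)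
  moreover have "?g (moment_map k d x) = x" if "x \<in> topspace (Euclidean_space d)" for x
    using that \<open>k \<ge> 1\<close> by (auto simp: topspace_Euclidean_space moment_map_def fun_eq_iff)
  ultimately show ?thesis
    by (intro section_imp_embedding_map)
      (auto simp: section_map_def retraction_maps_def intro!: exI[of _ ?g])
qed

lemma poly_as_linear_functional_of_moment_map:
  fixes q :: "real poly"
  assumes "degree q \<le> 2 * k" "d \<ge> 1" "k \<ge> 1"
  shows "\<exists>L :: (nat \<Rightarrow> real) \<Rightarrow> real. linear L \<and> (\<forall>x. poly q (x 0) = coeff q 0 + L (moment_map k d x))"
proof -
  \<comment> \<open>The coordinate that holds the \<open>j\<close>-th power of \<open>x 0\<close>.
    The constant term has no coordinate and stays outside the linear functional.\<close>
  let ?idx = "\<lambda>j::nat. if j = 1 then 0 else j + d - 2"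
  let ?L = "\<lambda>y :: nat \<Rightarrow> real. \<Sum>j\<in>{1..2*k}. coeff q j * y (?idx j)"
  have "linear ?L"
    by (rule linearI) (simp_all add: scaleR_fun_def sum.distrib sum_distrib_left algebra_simps)
  moreover have "poly q (x 0) = coeff q 0 + ?L (moment_map k d x)" for x
  proof -
    have m: "moment_map k d x (?idx j) = x 0 ^ j" if "j \<in> {1..2*k}" for j
    proof (cases "j = 1")
      case False
      with that assms(2) have "?idx j \<ge> d" "?idx j < 2 * k + d - 1" "?idx j + 2 - d = j" by auto
      then show ?thesis by (simp only: moment_map_def if_True if_False not_less[symmetric])
    qed (use assms(2,3) in \<open>simp add: moment_map_def\<close>)
    have "poly q (x 0) = (\<Sum>j\<le>2*k. coeff q j * x 0 ^ j)"
      unfolding poly_altdef using assms(1)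
      by (intro sum.mono_neutral_left) (auto simp: coeff_eq_0)
    also have "{..2*k} = insert 0 {1..2*k}" by auto
    also have "(\<Sum>j\<in>insert 0 {1..2*k}. coeff q j * x 0 ^ j) =
        coeff q 0 + (\<Sum>j\<in>{1..2*k}. coeff q j * x 0 ^ j)" by simp
    also have "(\<Sum>j\<in>{1..2*k}. coeff q j * x 0 ^ j) = ?L (moment_map k d x)"
      using m by (intro sum.cong) auto
    finally show ?thesis .
  qed
  ultimately show ?thesis by blast
qed

lemma neighborly_set_moment_map:
  assumes "k \<ge> 1" "d \<ge> 1" "finite A" and inj: "inj_on (\<lambda>x. x 0) A"
  shows "neighborly_set k (moment_map k d ` A)"
proof (rule neighborly_set_if_supporting_hyperplanes)
  have m0: "moment_map k d x 0 = x 0" for x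
    using assms(1,2) by (auto simp: moment_map_def)
  fix S assume S: "S \<subseteq> moment_map k d ` A" "card S \<le> k"
  have "finite S" using S(1) \<open>finite A\<close> by (auto intro: finite_subset)
  \<comment> \<open>By \<open>m0\<close> the images keep their first coordinate, so \<open>q\<close>
    is built from \<open>S\<close> without choosing preimages.\<close>
  define q :: "real poly" where "q = (\<Prod>s\<in>S. [:- s 0, 1:]\<^sup>2)"
  have "degree q = (\<Sum>s\<in>S. degree ([:- s 0, 1:]\<^sup>2))"
    unfolding q_def by (rule degree_prod_eq_sum_degree) simp
  also have "\<dots> = 2 * card S"
    by (simp add: degree_power_eq)
  finally have "degree q \<le> 2 * k" using S(2) by simp
  then obtain L where L: "linear L" "\<And>x. poly q (x 0) = coeff q 0 + L (moment_map k d x)"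
    using poly_as_linear_functional_of_moment_map assms(1,2) by blast
  have q: "poly q t = (\<Prod>s\<in>S. (t - s 0)\<^sup>2)" for t
    by (simp add: q_def poly_prod)
  \<comment> \<open>On the image, \<open>L\<close> is \<open>q\<close> minus its constant term, so
    \<open>q \<ge> 0\<close> gives the bound, with equality exactly at the roots of
    \<open>q\<close>.\<close>
  have ge: "- coeff q 0 \<le> L v" if "v \<in> moment_map k d ` A" for v
  proof -
    have "0 \<le> poly q t" for t by (simp add: q prod_nonneg)
    with that L(2) show ?thesis by (smt (verit) imageE)
  qed
  have eq: "L v = - coeff q 0 \<longleftrightarrow> v \<in> S" if v: "v \<in> moment_map k d ` A" for v
  proof -
    obtain x where x: "x \<in> A" "v = moment_map k d x" using v by blast
    have "L v = - coeff q 0 \<longleftrightarrow> poly q (x 0) = 0"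
      using L(2)[of x] x by auto
    also have "\<dots> \<longleftrightarrow> (\<exists>s\<in>S. x 0 = s 0)"
      using \<open>finite S\<close> by (simp add: q)
    also have "\<dots> \<longleftrightarrow> v \<in> S"
    proof
      assume "\<exists>s\<in>S. x 0 = s 0"
      then obtain s where s: "s \<in> S" "x 0 = s 0" by blast
      with S obtain y where y: "y \<in> A" "s = moment_map k d y" by blast
      \<comment> \<open>Distinct first coordinates exclude contact points outside
        \<open>S\<close>.\<close>
      with s x have "x = y" using inj by (auto simp: m0 dest: inj_onD)
      with s x y show "v \<in> S" by simp
    next
      assume "v \<in> S"
      then show "\<exists>s\<in>S. x 0 = s 0" using x by (intro bexI[of _ v]) (auto simp: m0)
    qed
    finally show ?thesis .
  qed
  show "\<exists>(L :: (nat \<Rightarrow> real) \<Rightarrow> real) c. linear L \<and> (\<forall>v\<in>moment_map k d ` A. c \<le> L v) \<and>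
      {v \<in> moment_map k d ` A. L v = c} = S"
  proof (intro exI conjI ballI)
    show "{v \<in> moment_map k d ` A. L v = - coeff q 0} = S"
      using eq S(1) by blast
  qed (use L(1) ge in auto)
qed (use assms in auto)

section \<open>Configurations with distinct first coordinates\<close>

lemma continuous_map_configuration_space_coord:
  assumes "i < n"
  shows "continuous_map (configuration_space d n) euclideanreal (\<lambda>x. x i j)"
proof -
  have "continuous_map (configuration_space d n) (Euclidean_space d) (\<lambda>x. x i)"
    unfolding configuration_space_def using assms by (intro continuous_map_product_projection) auto
  from continuous_map_compose[OF this continuous_map_Euclidean_space_coord[of d j]]
  show ?thesis by (simp add: o_def)
qed

definition distinct_first_coords :: "nat \<Rightarrow> nat \<Rightarrow> (nat \<Rightarrow> nat \<Rightarrow> real) set"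
  where "distinct_first_coords d n =
    {x \<in> topspace (configuration_space d n). inj_on (\<lambda>i. x i 0) {..<n}}"

text \<open>The product of all differences of first coordinates over pairs of distinct indices is
  continuous, and it vanishes exactly when two of them coincide.\<close>

lemma openin_distinct_first_coords:
  "openin (configuration_space d n) (distinct_first_coords d n)"
proof -
  let ?D = "SIGMA i:{..<n}. {..<n} - {i}"
  let ?g = "\<lambda>x :: nat \<Rightarrow> nat \<Rightarrow> real. \<Prod>(i, j)\<in>?D. x i 0 - x j 0"
  have "continuous_map (configuration_space d n) euclideanreal ?g"
    by (intro continuous_map_prod)
      (auto intro!: continuous_map_diff continuous_map_configuration_space_coord)
  then have "openin (configuration_space d n)
      {x \<in> topspace (configuration_space d n). ?g x \<in> - {0}}"
    by (rule openin_continuous_map_preimage) auto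
  also have "{x \<in> topspace (configuration_space d n). ?g x \<in> - {0}} = distinct_first_coords d n"
    by (auto simp: distinct_first_coords_def inj_on_def)
  finally show ?thesis .
qed

lemma dense_distinct_first_coords:
  assumes "d \<ge> 1"
  shows "configuration_space d n closure_of distinct_first_coords d n =
    topspace (configuration_space d n)"
  unfolding dense_intersects_open
proof (intro allI impI, elim conjE)
  fix W assume W: "openin (configuration_space d n) W" "W \<noteq> {}"
  then obtain x where x: "x \<in> W" by blast
  then have xtop: "x \<in> topspace (configuration_space d n)"
    using openin_subset[OF W(1)] by blast
  \<comment> \<open>Moving the points along the first axis at distinct speeds separates them for all but
    finitely many times.\<close>
  define h where "h t = (\<lambda>i\<in>{..<n}. \<lambda>j. x i j + (if j = 0 then t * real i else 0))" for t :: real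
  have x0: "x i j = 0" if "i < n" "d \<le> j" for i j
    using xtop that by (auto simp: configuration_space_def topspace_Euclidean_space PiE_iff)
  have h0: "h 0 = x"
    using xtop by (auto simp: h_def configuration_space_def PiE_iff extensional_def fun_eq_iff)
  have "continuous_map euclideanreal (Euclidean_space d) (\<lambda>t. h t i)" if "i < n" for i
  proof -
    \<comment> \<open>Since \<open>d \<ge> 1\<close>, the moved coordinate 0 is among the first
      \<open>d\<close>, so the path stays in the Euclidean space.\<close>
    have eq: "(\<lambda>t. h t i) =
        (\<lambda>t j. if j < d then x i j + (if j = 0 then t * real i else 0) else 0)"
      using x0[OF that] that assms by (auto simp: h_def fun_eq_iff)
    have "continuous_map euclideanreal euclideanreal
        (\<lambda>t. x i j + (if j = 0 then t * real i else 0))" for j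
      by (cases "j = 0") (auto intro!: continuous_intros)
    then show ?thesis
      unfolding eq by (subst continuous_map_componentwise_Euclidean_space) blast
  qed
  then have cont: "continuous_map euclideanreal (configuration_space d n) h"
    unfolding configuration_space_def continuous_map_componentwise
    by (auto simp: h_def)
  let ?T = "{t. h t \<in> W}"
  have "openin euclideanreal {t \<in> topspace euclideanreal. h t \<in> W}"
    by (rule openin_continuous_map_preimage[OF cont W(1)])
  then have "open ?T" by simp
  moreover have "0 \<in> ?T" using h0 x by simp
  ultimately have "infinite ?T" using finite_imp_not_open by blast
  \<comment> \<open>The finitely many collision times. Pairs with \<open>i = j\<close> contribute
    only the time 0, as division by zero yields 0. The open set \<open>?T\<close> is infinite, so
    some time in it avoids \<open>?B\<close>.\<close>
  let ?B = "(\<lambda>(i, j). (x j 0 - x i 0) / (real i - real j)) ` ({..<n} \<times> {..<n})"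
  have "\<not> ?T \<subseteq> ?B"
    using \<open>infinite ?T\<close> finite_subset by blast
  then obtain t where t: "h t \<in> W" "t \<notin> ?B" by blast
  have "inj_on (\<lambda>i. h t i 0) {..<n}"
  proof (rule inj_onI, rule ccontr)
    fix i j assume ij: "i \<in> {..<n}" "j \<in> {..<n}" "h t i 0 = h t j 0" "i \<noteq> j"
    then have "t = (x j 0 - x i 0) / (real i - real j)"
      by (simp add: h_def field_simps)
    with ij t(2) show False by force
  qed
  moreover have "h t \<in> topspace (configuration_space d n)"
    using openin_subset[OF W(1)] t(1) by (rule subsetD)
  ultimately have "h t \<in> distinct_first_coords d n"
    unfolding distinct_first_coords_def by blast
  with t(1) show "distinct_first_coords d n \<inter> W \<noteq> {}" by blast
qed

lemma distinct_first_coords_subset_neighborly_configurations: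
  assumes "k \<ge> 1" "d \<ge> 1"
  shows "distinct_first_coords d n \<subseteq> neighborly_configurations k d (moment_map k d) n"
proof
  fix x assume x: "x \<in> distinct_first_coords d n"
  then have "inj_on (\<lambda>y. y 0) (x ` {..<n})"
    by (auto simp: distinct_first_coords_def inj_on_def)
  then have "neighborly_set k (moment_map k d ` x ` {..<n})"
    using assms by (intro neighborly_set_moment_map) auto
  with x show "x \<in> neighborly_configurations k d (moment_map k d) n"
    by (simp add: neighborly_configurations_def distinct_first_coords_def image_image)
qed

theorem theorem4p4:
  fixes k d :: nat
  assumes "k \<ge> 1" and "d \<ge> 1"
  shows "(\<exists>\<phi>. generally_neighborly_embedding k d (2 * k + d - 1) \<phi>) \<and> p_g k d \<le> 2 * k + d - 1"
proof -
  have "generally_neighborly_embedding k d (2 * k + d - 1) (moment_map k d)"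
    unfolding generally_neighborly_embedding_def
  proof (intro conjI allI exI)
    show "embedding_map (Euclidean_space d) (Euclidean_space (2 * k + d - 1)) (moment_map k d)"
      using assms(1) by (rule embedding_map_moment_map)
    \<comment> \<open>This fixes the witness for the open dense set, which is still schematic up to
      here.\<close>
    show "distinct_first_coords d n \<subseteq> neighborly_configurations k d (moment_map k d) n" for n
      using assms by (rule distinct_first_coords_subset_neighborly_configurations)
  qed (fact openin_distinct_first_coords, rule dense_distinct_first_coords[OF assms(2)])
  then have ex: "\<exists>\<phi>. generally_neighborly_embedding k d (2 * k + d - 1) \<phi>"
    by (rule exI[of _ "moment_map k d"])
  moreover from ex have "p_g k d \<le> 2 * k + d - 1"
    unfolding p_g_def by (rule Least_le)
  ultimately show ?thesis ..
qed

end
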